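(* Let $\{\boldsymbol F_k^{(\kappa)}\}_{k=1}^K$, $\{\boldsymbol U_k^{(\kappa)}\}_{k=1}^{K+1}$, $\kappa=0,1,2,\dots$, be the iterates generated by the WSLM (wiretapped signal leakage minimization) interference alignment algorithm described in the context, for arbitrary channel matrices and arbitrary admissible initial precoders. Then the algorithm converges monotonically: the cost values $\mathfrak J^{(\kappa)}=\mathfrak J(\{\boldsymbol F_k^{(\kappa)}\}_{k=1}^K,\{\boldsymbol U_k^{(\kappa)}\}_{k=1}^{K+1})$ satisfy $\mathfrak J^{(\kappa+1)}\le \mathfrak J^{(\kappa)}$ for all $\kappa\ge 0$, and the sequence $(\mathfrak J^{(\kappa)})_{\kappa\ge0}$ converges.
   Context: Let $K,M,N,N_e,d$ be positive integers with $d\le\min(M,N,N_e)$, let $P_t>0$, and $\mathcal K=\{1,\dots,K\}$. There are $K$ transmitter-receiver pairs ($M$ transmit and $N$ receive antennas, $d$ data streams per pair) and an eavesdropper, indexed $K+1$, with $N_e$ antennas. The channel matrices are $\boldsymbol H_{k,\ell}\in\mathbb C^{N\times M}$ for $k,\ell\in\mathcal K$ and $\boldsymbol H_{K+1,\ell}\in\mathbb C^{N_e\times M}$ for $\ell\in\mathcal K$; they are fixed throughout the algorithm. Variables: precoders $\boldsymbol F_\ell\in\mathbb C^{M\times d}$ with $\boldsymbol F_\ell^H\boldsymbol F_\ell=\frac{P_t}{d}\boldsymbol I_d$ ($\ell\in\mathcal K$); matrices $\boldsymbol U_k\in\mathbb C^{N\times(N-d)}$ with $\boldsymbol U_k^H\boldsymbol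 U_k=\boldsymbol I$ ($k\in\mathcal K$); and $\boldsymbol U_{K+1}\in\mathbb C^{N_e\times d}$ with $\boldsymbol U_{K+1}^H\boldsymbol U_{K+1}=\boldsymbol I_d$. (If $N=d$, $\boldsymbol U_k\boldsymbol U_k^H$ is read as $\boldsymbol 0$ for $k\in\mathcal K$.) Cost function (total signal leakage), with $\|\cdot\|_F$ the Frobenius norm: $$\mathfrak J(\{\boldsymbol F_k\}_{k=1}^K,\{\boldsymbol U_k\}_{k=1}^{K+1})=\sum_{k\in\mathcal K}\sum_{\ell\in\mathcal K\setminus\{k\}}\|\boldsymbol H_{k,\ell}\boldsymbol F_\ell-\boldsymbol U_k\boldsymbol U_k^H\boldsymbol H_{k,\ell}\boldsymbol F_\ell\|_F^2+\sum_{\ell\in\mathcal K}\|\boldsymbol H_{K+1,\ell}\boldsymbol F_\ell-\boldsymbol U_{K+1}\boldsymbol U_{K+1}^H\boldsymbol H_{K+1,\ell}\boldsymbol F_\ell\|_F^2 .$$ For a Hermitian matrix $\boldsymbol X$, $\zeta_{\min}^{r}\{\boldsymbol X\}$ (resp. $\zeta_{\max}^{r}\{\boldsymbol X\}$) denotes a matrix whose columns are $r$ orthonormal eigenvectors of $\boldsymbol X$ corresponding to its $r$ smallest (resp. $r$ largest) eigenvalues, counted with multiplicity; ties are broken arbitrarily. WSLM algorithm (run without an iteration cap). Precoder update, given $\{\boldsymbol U_k\}_{k=1}^{K+1}$: for every $\ell\in\mathcal K$, $$\boldsymbol F_\ell=\sqrt{\tfrac{P_t}{d}}\;\zeta_{\min}^d\Big\{\sum_{k=1,k\ne\ell}^{K+1}\boldsymbol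 H_{k,\ell}^H(\boldsymbol I-\boldsymbol U_k\boldsymbol U_k^H)\boldsymbol H_{k,\ell}\Big\}.$$ Subspace update, given $\{\boldsymbol F_\ell\}_{\ell=1}^K$: $$\boldsymbol U_k=\zeta_{\max}^{N-d}\Big\{\sum_{\ell\in\mathcal K\setminus\{k\}}\boldsymbol H_{k,\ell}\boldsymbol F_\ell\boldsymbol F_\ell^H\boldsymbol H_{k,\ell}^H\Big\}\ (k\in\mathcal K),\qquad \boldsymbol U_{K+1}=\zeta_{\max}^{d}\Big\{\sum_{\ell\in\mathcal K}\boldsymbol H_{K+1,\ell}\boldsymbol F_\ell\boldsymbol F_\ell^H\boldsymbol H_{K+1,\ell}^H\Big\}.$$ Initialization: choose any $\{\boldsymbol F_k^{(0)}\}$ with $\boldsymbol F_k^{(0)H}\boldsymbol F_k^{(0)}=\frac{P_t}{d}\boldsymbol I_d$, and obtain $\{\boldsymbol U_k^{(0)}\}_{k=1}^{K+1}$ from the subspace update applied to $\{\boldsymbol F_k^{(0)}\}$. Iteration $\kappa\to\kappa+1$: obtain $\{\boldsymbol F_k^{(\kappa+1)}\}$ from the precoder update with $\{\boldsymbol U_k^{(\kappa)}\}$, then $\{\boldsymbol U_k^{(\kappa+1)}\}_{k=1}^{K+1}$ from the subspace update with $\{\boldsymbol F_k^{(\kappa+1)}\}$. *)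

theory Defs
  imports Complex_Main "Jordan_Normal_Form.Char_Poly" "Jordan_Normal_Form.Schur_Decomposition"
begin

text \<open>
  Transmitters and receivers carry the indices 1..K and the eavesdropper has index K + 1. Accordingly
  \<open>H k l\<close> is the channel from transmitter l to receiver k (eavesdropper if k = K + 1), \<open>F l\<close> is the
  precoder of transmitter l and \<open>U k\<close> the basis at receiver k. Values at other indices are irrelevant.
\<close>

definition frob_norm :: "complex mat \<Rightarrow> real" where
  "frob_norm A = sqrt (\<Sum>i<dim_row A. \<Sum>j<dim_col A. (cmod (A $$ (i, j)))\<^sup>2)"

definition mat_sum :: "nat \<Rightarrow> nat \<Rightarrow> ('i \<Rightarrow> complex mat) \<Rightarrow> 'i set \<Rightarrow> complex mat" where
  "mat_sum nr nc A I = mat nr nc (\<lambda>(i, j). \<Sum>k\<in>I. A k $$ (i, j))"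

text \<open>
  The list \<open>es @ fs\<close> contains all eigenvalues of X with algebraic multiplicity, and the columns of V are
  orthonormal eigenvectors for the eigenvalues in \<open>es\<close>. Eigenvalues are taken to be real, because the
  notion is only used for Hermitian X.
\<close>

definition eigenvalue_split ::
  "complex mat \<Rightarrow> complex mat \<Rightarrow> real list \<Rightarrow> real list \<Rightarrow> bool" where
  "eigenvalue_split X V es fs \<longleftrightarrow>
     char_poly X = (\<Prod>e\<leftarrow>es @ fs. [:- complex_of_real e, 1:]) \<and>
     V \<in> carrier_mat (dim_row X) (length es) \<and>
     mat_adjoint V * V = 1\<^sub>m (length es) \<and>
     (\<forall>i<length es. eigenvector X (col V i) (complex_of_real (es ! i)))"

text \<open>
  The matrices of r extremal eigenvectors are not unique (ties, choice and order of the eigenvectors),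
  so they are described by relations: \<open>zeta_min r X V\<close> says that V is one of the admissible choices.
\<close>

definition zeta_min :: "nat \<Rightarrow> complex mat \<Rightarrow> complex mat \<Rightarrow> bool" where
  "zeta_min r X V \<longleftrightarrow>
     (\<exists>es fs. length es = r \<and> eigenvalue_split X V es fs \<and> (\<forall>e\<in>set es. \<forall>f\<in>set fs. e \<le> f))"

definition zeta_max :: "nat \<Rightarrow> complex mat \<Rightarrow> complex mat \<Rightarrow> bool" where
  "zeta_max r X V \<longleftrightarrow>
     (\<exists>es fs. length es = r \<and> eigenvalue_split X V es fs \<and> (\<forall>e\<in>set es. \<forall>f\<in>set fs. f \<le> e))"

definition leakage ::
  "nat \<Rightarrow> (nat \<Rightarrow> nat \<Rightarrow> complex mat) \<Rightarrow> (nat \<Rightarrow> complex mat) \<Rightarrow> (nat \<Rightarrow> complex mat) \<Rightarrow> real" where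
  "leakage K H F U =
     (\<Sum>k\<in>{1..K}. \<Sum>l\<in>{1..K} - {k}.
        (frob_norm (H k l * F l - U k * mat_adjoint (U k) * H k l * F l))\<^sup>2) +
     (\<Sum>l\<in>{1..K}.
        (frob_norm (H (K + 1) l * F l
           - U (K + 1) * mat_adjoint (U (K + 1)) * H (K + 1) l * F l))\<^sup>2)"

definition admissible_precoders ::
  "nat \<Rightarrow> nat \<Rightarrow> nat \<Rightarrow> real \<Rightarrow> (nat \<Rightarrow> complex mat) \<Rightarrow> bool" where
  "admissible_precoders K M d Pt F \<longleftrightarrow>
     (\<forall>l\<in>{1..K}. F l \<in> carrier_mat M d \<and>
        mat_adjoint (F l) * F l = complex_of_real (Pt / real d) \<cdot>\<^sub>m 1\<^sub>m d)"

definition precoder_update ::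
  "nat \<Rightarrow> nat \<Rightarrow> nat \<Rightarrow> real \<Rightarrow> (nat \<Rightarrow> nat \<Rightarrow> complex mat) \<Rightarrow>
   (nat \<Rightarrow> complex mat) \<Rightarrow> (nat \<Rightarrow> complex mat) \<Rightarrow> bool" where
  "precoder_update K M d Pt H U F \<longleftrightarrow>
     (\<forall>l\<in>{1..K}. \<exists>V.
        zeta_min d
          (mat_sum M M
            (\<lambda>k. mat_adjoint (H k l) * (1\<^sub>m (dim_row (H k l)) - U k * mat_adjoint (U k)) * H k l)
            ({1..K + 1} - {l})) V \<and>
        F l = complex_of_real (sqrt (Pt / real d)) \<cdot>\<^sub>m V)"

text \<open>
  For N = d the matrix \<open>U k\<close> has no columns, and then \<open>U k * mat_adjoint (U k)\<close> is the zero matrix.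
\<close>

definition subspace_update ::
  "nat \<Rightarrow> nat \<Rightarrow> nat \<Rightarrow> nat \<Rightarrow> (nat \<Rightarrow> nat \<Rightarrow> complex mat) \<Rightarrow>
   (nat \<Rightarrow> complex mat) \<Rightarrow> (nat \<Rightarrow> complex mat) \<Rightarrow> bool" where
  "subspace_update K N Ne d H F U \<longleftrightarrow>
     (\<forall>k\<in>{1..K}.
        zeta_max (N - d)
          (mat_sum N N
            (\<lambda>l. H k l * F l * mat_adjoint (F l) * mat_adjoint (H k l)) ({1..K} - {k}))
          (U k)) \<and>
     zeta_max d
       (mat_sum Ne Ne
         (\<lambda>l. H (K + 1) l * F l * mat_adjoint (F l) * mat_adjoint (H (K + 1) l)) {1..K})
       (U (K + 1))"

definition wslm_iterates ::
  "nat \<Rightarrow> nat \<Rightarrow> nat \<Rightarrow> nat \<Rightarrow> nat \<Rightarrow> real \<Rightarrow> (nat \<Rightarrow> nat \<Rightarrow> complex mat) \<Rightarrow>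
   (nat \<Rightarrow> nat \<Rightarrow> complex mat) \<Rightarrow> (nat \<Rightarrow> nat \<Rightarrow> complex mat) \<Rightarrow> bool" where
  "wslm_iterates K M N Ne d Pt H F U \<longleftrightarrow>
     admissible_precoders K M d Pt (F 0) \<and>
     subspace_update K N Ne d H (F 0) (U 0) \<and>
     (\<forall>\<kappa>. precoder_update K M d Pt H (U \<kappa>) (F (Suc \<kappa>)) \<and>
          subspace_update K N Ne d H (F (Suc \<kappa>)) (U (Suc \<kappa>)))"

end

theory Submission
  imports Defs
begin

text \<open>
  Both half-steps of the algorithm are exact minimizations of the leakage over one block of variables.
  As \<open>I - U U\<^sup>H\<close> is a Hermitian idempotent, the leakage is a sum over the transmitters of
  \<open>tr (F\<^sub>l\<^sup>H X\<^sub>l F\<^sub>l)\<close>, where \<open>X\<^sub>l\<close> depends only on the subspaces, and also a sum over the receivers of a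
  constant minus \<open>tr (U\<^sub>k\<^sup>H S\<^sub>k U\<^sub>k)\<close>, where \<open>S\<^sub>k\<close> depends only on the precoders. By Ky Fan's trace theorem
  the extremal eigenvectors optimize these traces among all matrices with orthonormal columns. For Ky
  Fan, diagonalize \<open>X = Q D Q\<^sup>H\<close>: then \<open>tr (W\<^sup>H X W)\<close> is a combination of the eigenvalues with weights
  in [0, 1] that sum to the number of columns of W. The leakage is thus nonincreasing and nonnegative.
\<close>

section \<open>Adjoints and unitary diagonalization\<close>

lemma mat_adjoint_dim [simp]:
  "dim_row (mat_adjoint A) = dim_col A" "dim_col (mat_adjoint A) = dim_row A"
  by (simp_all add: mat_adjoint_def)

lemma mat_adjoint_carrier [simp]: "mat_adjoint A \<in> carrier_mat m n \<longleftrightarrow> A \<in> carrier_mat n m"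
  unfolding carrier_mat_def mem_Collect_eq mat_adjoint_dim by (rule conj_commute)

lemma mat_adjoint_index [simp]:
  fixes A :: "complex mat"
  shows "i < dim_col A \<Longrightarrow> j < dim_row A \<Longrightarrow> mat_adjoint A $$ (i, j) = cnj (A $$ (j, i))"
  by (simp add: mat_adjoint_def mat_of_rows_def)

lemma mat_adjoint_adjoint [simp]: "mat_adjoint (mat_adjoint A) = (A :: complex mat)"
  by (intro eq_matI) auto

lemma mat_adjoint_one [simp]: "mat_adjoint (1\<^sub>m n) = (1\<^sub>m n :: complex mat)"
  by (intro eq_matI) auto

lemma mat_adjoint_mult:
  fixes A B :: "complex mat"
  assumes "A \<in> carrier_mat n m" "B \<in> carrier_mat m k"
  shows "mat_adjoint (A * B) = mat_adjoint B * mat_adjoint A"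
  using assms by (intro eq_matI) (auto simp: scalar_prod_def intro!: sum.cong)

lemma mat_adjoint_minus:
  fixes A B :: "complex mat"
  assumes "A \<in> carrier_mat n m" "B \<in> carrier_mat n m"
  shows "mat_adjoint (A - B) = mat_adjoint A - mat_adjoint B"
  using assms by (intro eq_matI) auto

lemma mat_adjoint_smult:
  fixes A :: "complex mat"
  shows "mat_adjoint (c \<cdot>\<^sub>m A) = cnj c \<cdot>\<^sub>m mat_adjoint A"
  by (intro eq_matI) auto

lemma unitary_matI_scaled_columns:
  fixes ws :: "complex vec list"
  assumes ws: "set ws \<subseteq> carrier_vec n" "corthogonal ws" "length ws = n"
  shows "\<exists>W c. W \<in> carrier_mat n n \<and> mat_adjoint W * W = 1\<^sub>m n \<and>
           (\<forall>j<n. col W j = c j \<cdot>\<^sub>v ws ! j)"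
proof -
  \<comment> \<open>This is the reciprocal norm: the self-product is real and nonnegative, so taking
    its real part loses nothing.\<close>
  define c where "c j = complex_of_real (1 / sqrt (Re (ws ! j \<bullet>c ws ! j)))" for j
  define W where "W = mat n n (\<lambda>(i, j). c j * ws ! j $ i)"
  have W: "W \<in> carrier_mat n n" by (simp add: W_def)
  have wsj: "ws ! j \<in> carrier_vec n" if "j < n" for j
    using ws that by auto
  have ip: "ws ! j \<bullet>c ws ! i = (\<Sum>k<n. ws ! j $ k * cnj (ws ! i $ k))" if "i < n" "j < n" for i j
    using wsj[OF that(1)] wsj[OF that(2)] by (simp add: scalar_prod_def lessThan_atLeast0)
  have "mat_adjoint W * W = 1\<^sub>m n"
  proof (intro eq_matI)
    fix i j assume "i < dim_row (1\<^sub>m n :: complex mat)" "j < dim_col (1\<^sub>m n :: complex mat)"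
    then have i: "i < n" and j: "j < n" by auto
    have "row (mat_adjoint W) i \<bullet> col W j = (\<Sum>k<n. cnj (c i * ws ! i $ k) * (c j * ws ! j $ k))"
      using i j by (simp add: scalar_prod_def W_def lessThan_atLeast0)
    also have "\<dots> = c i * c j * (ws ! j \<bullet>c ws ! i)"
      unfolding ip[OF i j] by (simp add: sum_distrib_left sum_divide_distrib c_def mult_ac)
    also have "\<dots> = (if i = j then 1 else 0)"
    proof (cases "i = j")
      case False
      then show ?thesis using corthogonalD[OF ws(2)] ws(3) i j by auto
    next
      case True
      have eq: "ws ! i \<bullet>c ws ! i = complex_of_real (\<Sum>k<n. (cmod (ws ! i $ k))\<^sup>2)"
        unfolding ip[OF i i] of_real_sum
        by (simp only: complex_norm_square)
      define s where "s = (\<Sum>k<n. (cmod (ws ! i $ k))\<^sup>2)"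
      \<comment> \<open>\<open>corthogonal\<close> is an equivalence (product zero iff the indices
        differ), so on the diagonal it excludes zero vectors.\<close>
      have "s \<noteq> 0" using corthogonalD[OF ws(2), of i i] ws(3) i eq unfolding s_def by force
      moreover have "s \<ge> 0" unfolding s_def by (simp add: sum_nonneg)
      ultimately have "1 / sqrt s * (1 / sqrt s) * s = 1" by (simp add: field_simps)
      then show ?thesis using True eq unfolding c_def s_def[symmetric]
        by (metis Re_complex_of_real of_real_1 of_real_mult)
    qed
    finally show "(mat_adjoint W * W) $$ (i, j) = (1\<^sub>m n) $$ (i, j)"
      using i j W by simp
  qed (use W in auto)
  moreover have "col W j = c j \<cdot>\<^sub>v ws ! j" if "j < n" for j
    using that wsj[OF that] by (intro eq_vecI) (auto simp: W_def)
  ultimately show ?thesis using W by blast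
qed

text \<open>Complete v to a basis with v in front and orthogonalize; Gram-Schmidt leaves the first
  vector unchanged, so after normalization the first column is still parallel to v.\<close>

lemma unitary_completion:
  fixes v :: "complex vec"
  assumes v: "v \<in> carrier_vec n" "v \<noteq> 0\<^sub>v n" and n: "0 < n"
  shows "\<exists>W c. W \<in> carrier_mat n n \<and> mat_adjoint W * W = 1\<^sub>m n \<and> col W 0 = c \<cdot>\<^sub>v v"
proof -
  interpret cof_vec_space n "TYPE(complex)" .
  define b where "b = basis_completion v"
  define ws where "ws = gram_schmidt n b"
  from basis_completion[OF v, folded b_def]
  have dist_b: "distinct b" and indep: "\<not> lin_dep (set b)" and b: "set b \<subseteq> carrier_vec n"
    and hdb: "hd b = v" and len_b: "length b = n" by auto
  from hdb len_b n obtain vs where bv: "b = v # vs" by (cases b) auto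
  from gram_schmidt_result[OF b dist_b indep refl, folded ws_def]
  have ws: "set ws \<subseteq> carrier_vec n" "corthogonal ws" "length ws = n" by (auto simp: len_b)
  have "ws ! 0 = v"
    using gram_schmidt_hd[OF v(1), of vs, folded bv] ws(3) n unfolding ws_def
    by (metis hd_conv_nth length_greater_0_conv)
  then show ?thesis using unitary_matI_scaled_columns[OF ws] n by metis
qed

text \<open>Deflation by induction on the eigenvalue list. A unitary W whose first column is an
  eigenvector for e clears the first column of \<open>mat_adjoint W * A * W\<close> below the
  corner; being Hermitian, this matrix also has its first row cleared, and the remaining block is
  Hermitian with the remaining roots. The prescribed order of \<open>es\<close> survives on the
  diagonal, which later allows the selected eigenvalues to come first.\<close>

lemma hermitian_unitary_diagonalization:
  fixes A :: "complex mat"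
  assumes "A \<in> carrier_mat n n" "mat_adjoint A = A" "char_poly A = (\<Prod>e\<leftarrow>es. [:- e, 1:])"
  shows "\<exists>Q. similar_mat_wit A (mat n n (\<lambda>(i, j). if i = j then es ! i else 0)) Q (mat_adjoint Q)"
  using assms
proof (induction es arbitrary: n A)
  case Nil
  then have "n = 0" using degree_monic_char_poly[of A n] by auto
  with Nil show ?case
    by (intro exI[of _ "1\<^sub>m 0"] similar_mat_witI[of _ _ 0]) (auto intro!: eq_matI)
next
  case (Cons e es n A)
  note A = \<open>A \<in> carrier_mat n n\<close>
  have cp: "char_poly A = [:- e, 1:] * (\<Prod>e\<leftarrow>es. [:- e, 1:])" using Cons.prems(3) by simp
  have "monic (\<Prod>e\<leftarrow>es. [:- e, 1:])" by (rule monic_prod_list) auto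
  then have "degree (char_poly A) = Suc (degree (\<Prod>e\<leftarrow>es. [:- e, 1:]))"
    unfolding cp by (subst degree_mult_eq) auto
  with degree_monic_char_poly[OF A] obtain m where n: "n = Suc m" by (cases n) auto
  have "eigenvalue A e" unfolding eigenvalue_root_char_poly[OF A] cp by simp
  then obtain v where v: "v \<in> carrier_vec n" "v \<noteq> 0\<^sub>v n" and Av: "A *\<^sub>v v = e \<cdot>\<^sub>v v"
    using A unfolding eigenvalue_def eigenvector_def by auto
  obtain W c where W: "W \<in> carrier_mat n n" and WW: "mat_adjoint W * W = 1\<^sub>m n"
    and W0: "col W 0 = c \<cdot>\<^sub>v v"
    using unitary_completion[OF v] n by auto
  have WW': "W * mat_adjoint W = 1\<^sub>m n"
    using mat_mult_left_right_inverse[OF _ W WW] W by simp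
  define B where "B = mat_adjoint W * A * W"
  have B: "B \<in> carrier_mat n n" unfolding B_def using A W by (auto intro!: mult_carrier_mat)
  have simBA: "similar_mat_wit B A (mat_adjoint W) W"
    using A B W WW WW' B_def by (intro similar_mat_witI[of _ _ n]) auto
  have hermB: "mat_adjoint B = B"
    unfolding B_def using A W Cons.prems(2)
    by (simp add: mat_adjoint_mult[of _ n n _ n] assoc_mult_mat[of _ n n _ n _ n])
  \<comment> \<open>The first column of W is an eigenvector, so A acts on it as e, and
    \<open>mat_adjoint W\<close> sends it to the first unit vector.\<close>
  have Bcol: "B $$ (i, 0) = (if i = 0 then e else 0)" if "i < n" for i
  proof -
    have "A *\<^sub>v col W 0 = e \<cdot>\<^sub>v col W 0"
      unfolding W0 using A v(1) Av by (simp add: mult_mat_vec smult_smult_assoc mult.commute)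
    moreover have "B $$ (i, 0) = row (mat_adjoint W) i \<bullet> (A *\<^sub>v col W 0)"
      using that A W n unfolding B_def
      by (simp add: assoc_mult_mat[of _ n n _ n _ n] col_mult2[of _ n n _ n]
          mult_mat_vec_def)
    moreover have "row (mat_adjoint W) i \<bullet> col W 0 = (mat_adjoint W * W) $$ (i, 0)"
      using that W n by simp
    ultimately show ?thesis
      using that W n by (simp add: WW)
  qed
  have n0: "0 < n" using n by simp
  define A3 where "A3 = mat m m (\<lambda>(i, j). B $$ (Suc i, Suc j))"
  define E where "E = mat 1 1 (\<lambda>_. e)"
  have A3: "A3 \<in> carrier_mat m m" and E: "E \<in> carrier_mat 1 1" by (simp_all add: A3_def E_def)
  have Bherm: "B $$ (j, i) = cnj (B $$ (i, j))" if "i < n" "j < n" for i j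
  proof -
    have "mat_adjoint B $$ (j, i) = cnj (B $$ (i, j))" using that B by simp
    then show ?thesis by (simp only: hermB)
  qed
  have Bblock: "B = four_block_mat E (0\<^sub>m 1 m) (0\<^sub>m m 1) A3"
  proof (intro eq_matI)
    fix i j
    assume "i < dim_row (four_block_mat E (0\<^sub>m 1 m) (0\<^sub>m m 1) A3)"
      and "j < dim_col (four_block_mat E (0\<^sub>m 1 m) (0\<^sub>m m 1) A3)"
    then have ij: "i < n" "j < n" using n by (auto simp: E_def A3_def)
    show "B $$ (i, j) = four_block_mat E (0\<^sub>m 1 m) (0\<^sub>m m 1) A3 $$ (i, j)"
    proof (cases i)
      case 0
      \<comment> \<open>The first row is the conjugate of the first column. At the corner this
        matches \<open>E\<close> because e, a diagonal entry of a Hermitian matrix, is real.\<close>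
      then have "B $$ (i, j) = cnj (B $$ (j, 0))" using Bherm[OF ij(2,1)] ij Bherm by blast
      moreover have "cnj e = e" using Bherm[OF n0 n0] unfolding Bcol[OF n0] by simp
      ultimately show ?thesis
        using 0 ij n Bcol[OF ij(2)] by (cases j) (simp_all add: E_def A3_def)
    next
      case (Suc i')
      then show ?thesis
        using ij n Bcol[OF ij(1)] by (cases j) (simp_all add: E_def A3_def)
    qed
  qed (use B n in \<open>auto simp: E_def A3_def\<close>)
  have hermA3: "mat_adjoint A3 = A3"
    by (intro eq_matI) (auto simp: A3_def n intro!: Bherm[symmetric])
  have "char_poly B = char_poly A"
    using simBA by (intro char_poly_similar) (auto simp: similar_mat_def)
  moreover have "char_poly B = char_poly E * char_poly A3"
    unfolding Bblock by (rule char_poly_four_block_zeros_col[OF E _ A3]) simp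
  moreover have "char_poly E = [:- e, 1:]"
    by (simp add: E_def char_poly_defs det_def sign_def)
  \<comment> \<open>The characteristic polynomial of the block matrix is a product, and the factor
    \<open>[:- e, 1:]\<close> cancels.\<close>
  ultimately have "char_poly A3 = (\<Prod>e\<leftarrow>es. [:- e, 1:])"
    unfolding cp by (metis mult_cancel_left pCons_eq_0_iff zero_neq_one)
  from Cons.IH[OF A3 hermA3 this] obtain P
    where P: "similar_mat_wit A3 (mat m m (\<lambda>(i, j). if i = j then es ! i else 0)) P (mat_adjoint P)"
      (is "similar_mat_wit A3 ?D P _")
    by blast
  note Pc = similar_mat_witD2(6)[OF A3 P]
  \<comment> \<open>The diagonalizer P of the smaller block is extended by a 1 in the corner;
    composed with W it diagonalizes A.\<close>
  let ?P = "four_block_mat (1\<^sub>m 1) (0\<^sub>m 1 m) (0\<^sub>m m 1) P"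
  have simB: "similar_mat_wit B (four_block_mat E (0\<^sub>m 1 m) (0\<^sub>m m 1) ?D) ?P
          (four_block_mat (1\<^sub>m 1) (0\<^sub>m 1 m) (0\<^sub>m m 1) (mat_adjoint P))"
    unfolding Bblock
    by (rule similar_mat_wit_four_block[OF similar_mat_wit_refl[OF E] P _ _ E A3])
       (use Pc in auto)
  have adjP: "four_block_mat (1\<^sub>m 1) (0\<^sub>m 1 m) (0\<^sub>m m 1) (mat_adjoint P) = mat_adjoint ?P"
    using Pc by (intro eq_matI) auto
  have diag: "four_block_mat E (0\<^sub>m 1 m) (0\<^sub>m m 1) ?D
      = mat n n (\<lambda>(i, j). if i = j then (e # es) ! i else 0)"
    by (rule eq_matI) (auto simp: E_def n nth_Cons')
  have "mat_adjoint ?P * mat_adjoint W = mat_adjoint (W * ?P)"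
    using W Pc n by (intro mat_adjoint_mult[symmetric, of _ n n _ n]) auto
  then show ?case
    using similar_mat_wit_trans[OF similar_mat_wit_sym[OF simBA] simB] unfolding diag adjP
    by (intro exI[of _ "W * ?P"]) simp
qed

section \<open>Ky Fan's trace theorem\<close>

definition mat_trace :: "complex mat \<Rightarrow> complex" where
  "mat_trace A = (\<Sum>i<dim_row A. A $$ (i, i))"

lemma mat_trace_comm:
  assumes "A \<in> carrier_mat n m" "B \<in> carrier_mat m n"
  shows "mat_trace (A * B) = mat_trace (B * A)"
proof -
  have "mat_trace (A * B) = (\<Sum>i<n. \<Sum>j<m. A $$ (i, j) * B $$ (j, i))"
    using assms by (simp add: mat_trace_def scalar_prod_def lessThan_atLeast0)
  also have "\<dots> = (\<Sum>j<m. \<Sum>i<n. B $$ (j, i) * A $$ (i, j))"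
    by (subst sum.swap) (simp add: mult.commute)
  also have "\<dots> = mat_trace (B * A)"
    using assms by (simp add: mat_trace_def scalar_prod_def lessThan_atLeast0)
  finally show ?thesis .
qed

lemma mat_trace_add:
  assumes "A \<in> carrier_mat n n" "B \<in> carrier_mat n n"
  shows "mat_trace (A + B) = mat_trace A + mat_trace B"
  using assms by (simp add: mat_trace_def sum.distrib)

lemma mat_trace_minus:
  assumes "A \<in> carrier_mat n n" "B \<in> carrier_mat n n"
  shows "mat_trace (A - B) = mat_trace A - mat_trace B"
  using assms by (simp add: mat_trace_def sum_subtractf)

lemma mat_trace_smult:
  assumes "A \<in> carrier_mat n n"
  shows "mat_trace (c \<cdot>\<^sub>m A) = c * mat_trace A"
  using assms by (simp add: mat_trace_def sum_distrib_left)

lemma frob_norm_sq: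
  "complex_of_real ((frob_norm A)\<^sup>2) = mat_trace (mat_adjoint A * A)"
proof -
  have "complex_of_real ((frob_norm A)\<^sup>2)
      = (\<Sum>i<dim_row A. \<Sum>j<dim_col A. A $$ (i, j) * cnj (A $$ (i, j)))"
    by (simp add: frob_norm_def sum_nonneg complex_norm_square del: of_real_power)
  also have "\<dots> = mat_trace (mat_adjoint A * A)"
    by (subst sum.swap) (simp add: mat_trace_def scalar_prod_def lessThan_atLeast0 mult.commute)
  finally show ?thesis .
qed

text \<open>The row norms are the diagonal entries t of the projection \<open>Y * mat_adjoint Y\<close>, and a
  Hermitian idempotent satisfies \<open>t\<^sup>2 \<le> t\<close> on its diagonal.\<close>

lemma isometry_row_norm_le_1:
  assumes Y: "Y \<in> carrier_mat n r" and iso: "mat_adjoint Y * Y = 1\<^sub>m r" and i: "i < n"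
  shows "(\<Sum>j<r. (cmod (Y $$ (i, j)))\<^sup>2) \<le> 1"
proof -
  define P where "P = Y * mat_adjoint Y"
  define t where "t = (\<Sum>j<r. (cmod (Y $$ (i, j)))\<^sup>2)"
  have P: "P \<in> carrier_mat n n" using Y by (auto simp: P_def intro!: mult_carrier_mat)
  have "P * P = Y * (mat_adjoint Y * Y) * mat_adjoint Y"
    using Y by (simp add: P_def assoc_mult_mat[of _ n r _ n _ n] assoc_mult_mat[of _ n r _ r _ n]
        assoc_mult_mat[of _ r n _ r _ n] mult_carrier_mat)
  then have PP: "P * P = P" using Y by (simp add: iso P_def)
  have "mat_adjoint P = P" using Y by (simp add: P_def mat_adjoint_mult[of _ n r _ n])
  then have cnjP: "cnj (P $$ (i, k)) = P $$ (k, i)" if "k < n" for k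
    using mat_adjoint_index[of k P i] P i that by simp
  have Pii: "P $$ (i, i) = complex_of_real t"
    using Y i by (simp add: P_def t_def scalar_prod_def lessThan_atLeast0 complex_norm_square
        del: of_real_power)
  \<comment> \<open>By idempotence t is also the diagonal entry of \<open>P * P\<close>, which for
    Hermitian P is the squared norm of row i; the term k = i alone contributes
    \<open>t\<^sup>2\<close>.\<close>
  have "complex_of_real t = (\<Sum>k<n. P $$ (i, k) * P $$ (k, i))"
    unfolding Pii[symmetric] using P i
    by (subst PP[symmetric]) (simp add: scalar_prod_def lessThan_atLeast0)
  also have "\<dots> = complex_of_real (\<Sum>k<n. (cmod (P $$ (i, k)))\<^sup>2)"
    unfolding of_real_sum by (intro sum.cong) (simp_all only: complex_norm_square cnjP lessThan_iff)
  finally have "t = (\<Sum>k<n. (cmod (P $$ (i, k)))\<^sup>2)" by (simp only: of_real_eq_iff)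
  moreover have "(cmod (P $$ (i, i)))\<^sup>2 \<le> (\<Sum>k<n. (cmod (P $$ (i, k)))\<^sup>2)"
    using i by (intro member_le_sum) auto
  moreover have "cmod (P $$ (i, i)) = \<bar>t\<bar>" by (simp only: Pii norm_of_real)
  ultimately have "t\<^sup>2 \<le> t" by (simp only: power2_abs)
  then have "t * t \<le> t * 1" by (simp add: power2_eq_square)
  moreover have "0 \<le> t" by (simp add: t_def sum_nonneg)
  ultimately have "t \<le> 1" by (cases "t = 0") (auto simp: mult_le_cancel_left)
  then show ?thesis by (simp add: t_def)
qed

text \<open>In an eigenbasis Q of X, W becomes the isometry \<open>Y = mat_adjoint Q * W\<close>,
  and the weight \<open>p i\<close> is the squared norm of row i of Y. Row norms of an isometry are
  at most 1, and their total is the trace of \<open>mat_adjoint Y * Y\<close>. Optimizing over W is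
  thereby reduced to a linear problem in the weights.\<close>

lemma hermitian_compression_trace:
  assumes X: "X \<in> carrier_mat n n" "mat_adjoint X = X"
    and cp: "char_poly X = (\<Prod>e\<leftarrow>ls. [:- complex_of_real e, 1:])"
    and W: "W \<in> carrier_mat n r" and iso: "mat_adjoint W * W = 1\<^sub>m r"
  obtains p :: "nat \<Rightarrow> real" where "\<And>i. i < n \<Longrightarrow> 0 \<le> p i \<and> p i \<le> 1" "(\<Sum>i<n. p i) = r"
    "Re (mat_trace (mat_adjoint W * X * W)) = (\<Sum>i<n. ls ! i * p i)" "length ls = n"
proof -
  define D where "D = mat n n (\<lambda>(i, j). if i = j then map complex_of_real ls ! i else 0)"
  have D: "D \<in> carrier_mat n n" by (simp add: D_def)
  have "char_poly X = (\<Prod>e\<leftarrow>map complex_of_real ls. [:- e, 1:])"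
    unfolding cp by (simp add: o_def)
  from hermitian_unitary_diagonalization[OF X this]
  obtain Q where sim: "similar_mat_wit X D Q (mat_adjoint Q)" unfolding D_def by blast
  have Q: "Q \<in> carrier_mat n n" and XQ: "X = Q * D * mat_adjoint Q"
    and QQ: "Q * mat_adjoint Q = 1\<^sub>m n"
    using similar_mat_witD2[OF X(1) sim] by auto
  have len: "length ls = n"
    using degree_monic_char_poly[OF X(1)] unfolding cp
    by (metis degree_linear_factors)
  define Y where "Y = mat_adjoint Q * W"
  have Y: "Y \<in> carrier_mat n r" using Q W by (auto simp: Y_def intro!: mult_carrier_mat)
  have adjY: "mat_adjoint Y = mat_adjoint W * Q"
    using Q W by (simp add: Y_def mat_adjoint_mult[of _ n n _ r])
  have "mat_adjoint Y * Y = mat_adjoint W * (Q * mat_adjoint Q) * W"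
    using Q W unfolding adjY
    by (simp add: Y_def assoc_mult_mat[of _ r n _ n _ r] assoc_mult_mat[of _ n n _ n _ r]
        mult_carrier_mat)
  then have isoY: "mat_adjoint Y * Y = 1\<^sub>m r" using W by (simp add: QQ iso)
  have "mat_adjoint W * X * W = mat_adjoint Y * (D * Y)"
    using Q W D unfolding adjY XQ
    by (simp add: Y_def assoc_mult_mat[of _ r n _ n _ r] assoc_mult_mat[of _ n n _ n _ r]
        assoc_mult_mat[of _ n n _ n _ n] mult_carrier_mat)
  also have "mat_trace \<dots> = (\<Sum>j<r. \<Sum>i<n. cnj (Y $$ (i, j)) * (ls ! i * Y $$ (i, j)))"
  proof -
    have "(D * Y) $$ (i, j) = ls ! i * Y $$ (i, j)" if "i < n" "j < r" for i j
    proof -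
      have "(D * Y) $$ (i, j) = (\<Sum>k<n. D $$ (i, k) * Y $$ (k, j))"
        using that Y D by (simp add: scalar_prod_def lessThan_atLeast0)
      also have "\<dots> = (\<Sum>k<n. if i = k then complex_of_real (ls ! i) * Y $$ (k, j) else 0)"
        using that len by (intro sum.cong) (auto simp: D_def)
      finally show ?thesis using that by simp
    qed
    then show ?thesis
      using Y D by (simp add: mat_trace_def scalar_prod_def lessThan_atLeast0)
  qed
  also have "\<dots> = (\<Sum>i<n. \<Sum>j<r. complex_of_real (ls ! i) * (Y $$ (i, j) * cnj (Y $$ (i, j))))"
    by (subst sum.swap) (simp add: mult_ac)
  also have "\<dots> = complex_of_real (\<Sum>i<n. ls ! i * (\<Sum>j<r. (cmod (Y $$ (i, j)))\<^sup>2))"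
    by (simp add: sum_distrib_left complex_norm_square del: of_real_power)
  finally have tr: "Re (mat_trace (mat_adjoint W * X * W))
      = (\<Sum>i<n. ls ! i * (\<Sum>j<r. (cmod (Y $$ (i, j)))\<^sup>2))" by simp
  have "complex_of_real (\<Sum>i<n. \<Sum>j<r. (cmod (Y $$ (i, j)))\<^sup>2) = mat_trace (mat_adjoint Y * Y)"
    using Y frob_norm_sq[of Y] by (simp add: frob_norm_def sum_nonneg)
  also have "\<dots> = complex_of_real (real r)" by (simp add: isoY mat_trace_def)
  finally have "(\<Sum>i<n. \<Sum>j<r. (cmod (Y $$ (i, j)))\<^sup>2) = real r" by (simp only: of_real_eq_iff)
  with tr len isometry_row_norm_le_1[OF Y isoY] show ?thesis
    by (intro that[of "\<lambda>i. \<Sum>j<r. (cmod (Y $$ (i, j)))\<^sup>2"]) (auto simp: sum_nonneg)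
qed

text \<open>Diagonal entry i of the compression is the Rayleigh quotient of a unit eigenvector,
  hence its eigenvalue.\<close>

lemma eigenvalue_split_trace:
  assumes X: "X \<in> carrier_mat n n" and "eigenvalue_split X V es fs"
  shows "Re (mat_trace (mat_adjoint V * X * V)) = sum_list es"
proof -
  let ?r = "length es"
  have V: "V \<in> carrier_mat n ?r" and iso: "mat_adjoint V * V = 1\<^sub>m ?r"
    and ev: "\<And>i. i < ?r \<Longrightarrow> X *\<^sub>v col V i = complex_of_real (es ! i) \<cdot>\<^sub>v col V i"
    using assms by (auto simp: eigenvalue_split_def eigenvector_def)
  have "(mat_adjoint V * X * V) $$ (i, i) = complex_of_real (es ! i)" if i: "i < ?r" for i
  proof -
    have "(mat_adjoint V * X * V) $$ (i, i) = row (mat_adjoint V) i \<bullet> (X *\<^sub>v col V i)"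
      using i V X by (simp add: assoc_mult_mat[of _ ?r n _ n _ ?r] col_mult2[of _ n n _ ?r]
          mult_mat_vec_def)
    also have "\<dots> = complex_of_real (es ! i) * (mat_adjoint V * V) $$ (i, i)"
      using i V X by (simp add: ev)
    finally show ?thesis using i by (simp add: iso)
  qed
  then show ?thesis
    using V by (simp add: mat_trace_def sum_list_sum_nth lessThan_atLeast0)
qed

lemma threshold_exists:
  fixes es fs :: "real list"
  assumes "\<forall>e\<in>set es. \<forall>f\<in>set fs. e \<le> f"
  obtains c where "\<And>e. e \<in> set es \<Longrightarrow> e \<le> c" "\<And>f. f \<in> set fs \<Longrightarrow> c \<le> f"
proof (cases "es = []")
  case True
  \<comment> \<open>Inserting 0 keeps the minimum defined when \<open>fs\<close> is empty as well.
    An empty \<open>es\<close> does occur: it is the case N = d of the subspace update.\<close>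
  then show ?thesis using that[of "Min (insert 0 (set fs))"] by auto
next
  case False
  then show ?thesis using that[of "Max (set es)"] assms by auto
qed

text \<open>Subtract a threshold c separating the two lists. Each term \<open>(x - c) * p\<close>
  with p in [0, 1] is smallest at p = 1 when x is below c and at p = 0 when x is above it. Since the
  weights sum to \<open>length es\<close>, the subtraction shifts both sides by the same
  amount.\<close>

lemma sum_list_le_weighted_sum:
  fixes es fs :: "real list" and p :: "nat \<Rightarrow> real"
  assumes le: "\<forall>e\<in>set es. \<forall>f\<in>set fs. e \<le> f"
    and len: "length (es @ fs) = n"
    and p: "\<And>i. i < n \<Longrightarrow> 0 \<le> p i \<and> p i \<le> 1" and sum_p: "(\<Sum>i<n. p i) = length es"
  shows "sum_list es \<le> (\<Sum>i<n. (es @ fs) ! i * p i)"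
proof -
  obtain c where c: "\<And>e. e \<in> set es \<Longrightarrow> e \<le> c" "\<And>f. f \<in> set fs \<Longrightarrow> c \<le> f"
    using threshold_exists[OF le] by blast
  let ?x = "\<lambda>i. (es @ fs) ! i"
  have "(if i < length es then ?x i - c else 0) \<le> (?x i - c) * p i" if "i < n" for i
  proof (cases "i < length es")
    case True
    then have "(c - ?x i) * p i \<le> (c - ?x i) * 1"
      using c(1) p[OF that] by (intro mult_left_mono) (auto simp: nth_append)
    then show ?thesis using True by (simp add: algebra_simps)
  next
    case False
    then have "0 \<le> (?x i - c) * p i"
      using c(2) p[OF that] that len by (intro mult_nonneg_nonneg) (auto simp: nth_append)
    then show ?thesis using False by simp
  qed
  then have "(\<Sum>i<n. if i < length es then ?x i - c else 0) \<le> (\<Sum>i<n. (?x i - c) * p i)"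
    by (intro sum_mono) simp
  also have "\<dots> = (\<Sum>i<n. ?x i * p i) - c * length es"
    by (simp add: left_diff_distrib sum_subtractf sum_p[symmetric] sum_distrib_left)
  also have "(\<Sum>i<n. if i < length es then ?x i - c else 0) = (\<Sum>i<length es. es ! i - c)"
    using len by (intro sum.mono_neutral_cong_right) (auto simp: nth_append)
  also have "\<dots> = sum_list es - c * length es"
    by (simp add: sum_subtractf sum_list_sum_nth lessThan_atLeast0 mult.commute)
  finally show ?thesis by simp
qed

text \<open>Ky Fan's minimum principle: V realizes the extreme weights, one on \<open>es\<close> and
  zero on \<open>fs\<close>, while W realizes some admissible weights.\<close>

lemma zeta_min_trace_le:
  assumes X: "X \<in> carrier_mat n n" "mat_adjoint X = X" and V: "zeta_min r X V"
    and W: "W \<in> carrier_mat n r" "mat_adjoint W * W = 1\<^sub>m r"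
  shows "Re (mat_trace (mat_adjoint V * X * V)) \<le> Re (mat_trace (mat_adjoint W * X * W))"
proof -
  obtain es fs where r: "length es = r" and split: "eigenvalue_split X V es fs"
    and le: "\<forall>e\<in>set es. \<forall>f\<in>set fs. e \<le> f"
    using V unfolding zeta_min_def by blast
  then have "char_poly X = (\<Prod>e\<leftarrow>es @ fs. [:- complex_of_real e, 1:])"
    by (simp add: eigenvalue_split_def)
  from hermitian_compression_trace[OF X this W] obtain p
    where p: "\<And>i. i < n \<Longrightarrow> 0 \<le> p i \<and> p i \<le> 1" "(\<Sum>i<n. p i) = real r"
      "Re (mat_trace (mat_adjoint W * X * W)) = (\<Sum>i<n. (es @ fs) ! i * p i)"
      "length (es @ fs) = n" by blast
  show ?thesis
    unfolding eigenvalue_split_trace[OF X(1) split] p(3)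
    using sum_list_le_weighted_sum[OF le p(4) p(1)] p(2) r by simp
qed

text \<open>The maximum principle follows from the same weight inequality applied to the negated
  eigenvalues, so X itself need not be negated.\<close>

lemma zeta_max_trace_ge:
  assumes X: "X \<in> carrier_mat n n" "mat_adjoint X = X" and V: "zeta_max r X V"
    and W: "W \<in> carrier_mat n r" "mat_adjoint W * W = 1\<^sub>m r"
  shows "Re (mat_trace (mat_adjoint W * X * W)) \<le> Re (mat_trace (mat_adjoint V * X * V))"
proof -
  obtain es fs where r: "length es = r" and split: "eigenvalue_split X V es fs"
    and le: "\<forall>e\<in>set es. \<forall>f\<in>set fs. f \<le> e"
    using V unfolding zeta_max_def by blast
  then have "char_poly X = (\<Prod>e\<leftarrow>es @ fs. [:- complex_of_real e, 1:])"
    by (simp add: eigenvalue_split_def)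
  from hermitian_compression_trace[OF X this W] obtain p
    where p: "\<And>i. i < n \<Longrightarrow> 0 \<le> p i \<and> p i \<le> 1" "(\<Sum>i<n. p i) = real r"
      "Re (mat_trace (mat_adjoint W * X * W)) = (\<Sum>i<n. (es @ fs) ! i * p i)"
      "length (es @ fs) = n" by blast
  have "sum_list (map uminus es) \<le> (\<Sum>i<n. (map uminus es @ map uminus fs) ! i * p i)"
    using le p r by (intro sum_list_le_weighted_sum) auto
  also have "\<dots> = - (\<Sum>i<n. (es @ fs) ! i * p i)"
    unfolding sum_negf[symmetric] map_append[symmetric]
    using p(4) by (intro sum.cong) (auto simp del: map_append)
  also have "sum_list (map uminus es) = - sum_list es"
    by (induction es) auto
  finally show ?thesis
    unfolding eigenvalue_split_trace[OF X(1) split] p(3) by simp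
qed

section \<open>Leakage as a trace\<close>

lemma mat_sum_carrier [simp]: "mat_sum n m A I \<in> carrier_mat n m"
  by (simp add: mat_sum_def)

lemma mat_sum_hermitian:
  assumes "\<And>k. k \<in> I \<Longrightarrow> A k \<in> carrier_mat n n \<and> mat_adjoint (A k) = A k"
  shows "mat_adjoint (mat_sum n n A I) = mat_sum n n A I"
proof (rule eq_matI)
  fix i j assume "i < dim_row (mat_sum n n A I)" "j < dim_col (mat_sum n n A I)"
  then have ij: "i < n" "j < n" by (auto simp: mat_sum_def)
  have "cnj (A k $$ (j, i)) = A k $$ (i, j)" if "k \<in> I" for k
    using mat_adjoint_index[of i "A k" j] assms[OF that] ij by auto
  then show "mat_adjoint (mat_sum n n A I) $$ (i, j) = mat_sum n n A I $$ (i, j)"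
    using ij by (simp add: mat_sum_def)
qed (simp_all add: mat_sum_def)

lemma mat_trace_compression_mat_sum:
  assumes "finite I" and "\<And>k. k \<in> I \<Longrightarrow> A k \<in> carrier_mat n n" and W: "W \<in> carrier_mat n r"
  shows "mat_trace (mat_adjoint W * mat_sum n n A I * W)
    = (\<Sum>k\<in>I. mat_trace (mat_adjoint W * A k * W))"
  using assms(1,2)
proof (induction I)
  case empty
  have "mat_sum n n A {} = 0\<^sub>m n n" by (intro eq_matI) (auto simp: mat_sum_def)
  then show ?case using W by (simp add: mat_trace_def)
next
  case (insert k I)
  have Ak: "A k \<in> carrier_mat n n" using insert.prems by simp
  have "mat_sum n n A (insert k I) = A k + mat_sum n n A I"
    using insert.hyps Ak by (intro eq_matI) (auto simp: mat_sum_def)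
  then have sum_split: "mat_adjoint W * mat_sum n n A (insert k I) * W
      = mat_adjoint W * A k * W + mat_adjoint W * mat_sum n n A I * W"
    using W Ak by (simp add: mult_add_distrib_mat[of _ r n _ n]
        add_mult_distrib_mat[of _ r n _ _ r] mult_carrier_mat[of _ r n])
  have "mat_adjoint W * A k * W \<in> carrier_mat r r"
    "mat_adjoint W * mat_sum n n A I * W \<in> carrier_mat r r"
    using W Ak by (auto intro!: mult_carrier_mat)
  from mat_trace_add[OF this] show ?case
    using insert by (simp add: sum_split del: assoc_mult_mat)
qed

text \<open>Precoders are isometries scaled by a real constant; this factors the constant out so
  that Ky Fan's theorem becomes applicable.\<close>

lemma mat_trace_compression_smult:
  assumes "W \<in> carrier_mat n r" "X \<in> carrier_mat n n"
  shows "mat_trace (mat_adjoint (complex_of_real c \<cdot>\<^sub>m W) * X * (complex_of_real c \<cdot>\<^sub>m W))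
    = complex_of_real (c\<^sup>2) * mat_trace (mat_adjoint W * X * W)"
proof -
  let ?c = "complex_of_real c"
  have c: "mat_adjoint W * X \<in> carrier_mat r n" "mat_adjoint W * X * W \<in> carrier_mat r r"
    using assms by (auto intro!: mult_carrier_mat)
  have "mat_adjoint (?c \<cdot>\<^sub>m W) * X * (?c \<cdot>\<^sub>m W) = ?c \<cdot>\<^sub>m (mat_adjoint W * X) * (?c \<cdot>\<^sub>m W)"
    using assms by (simp add: mat_adjoint_smult mult_smult_assoc_mat[of _ r n _ n] del: assoc_mult_mat)
  also have "\<dots> = ?c \<cdot>\<^sub>m (?c \<cdot>\<^sub>m (mat_adjoint W * X * W))"
    using assms c by (simp add: mult_smult_assoc_mat[of _ r n _ r] mult_smult_distrib[of _ r n _ r]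
        del: assoc_mult_mat)
  finally show ?thesis
    using c(2) by (simp add: mat_trace_smult[of _ r] power2_eq_square del: assoc_mult_mat)
qed

lemma mat_adjoint_congruence:
  fixes R B :: "complex mat"
  assumes R: "R \<in> carrier_mat n n" "mat_adjoint R = R" and B: "B \<in> carrier_mat n m"
  shows "mat_adjoint (mat_adjoint B * R * B) = mat_adjoint B * R * B"
proof -
  have BR: "mat_adjoint B * R \<in> carrier_mat m n" and B': "mat_adjoint B \<in> carrier_mat m n"
    using R B by (auto intro!: mult_carrier_mat)
  show ?thesis
    unfolding mat_adjoint_mult[OF BR B] mat_adjoint_mult[OF B' R(1)] R(2) mat_adjoint_adjoint
    by (rule assoc_mult_mat[OF B' R(1) B, symmetric])
qed

lemma mat_adjoint_congruence_mult:
  fixes R B C :: "complex mat"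
  assumes R: "R \<in> carrier_mat n n" and B: "B \<in> carrier_mat n m" and C: "C \<in> carrier_mat m k"
  shows "mat_adjoint (B * C) * R * (B * C) = mat_adjoint C * (mat_adjoint B * R * B) * C"
proof -
  have B': "mat_adjoint B \<in> carrier_mat m n" and C': "mat_adjoint C \<in> carrier_mat k m"
    using B C by auto
  note BR = mult_carrier_mat[OF B' R]
  have "mat_adjoint (B * C) * R * (B * C) = mat_adjoint C * (mat_adjoint B * R) * (B * C)"
    unfolding mat_adjoint_mult[OF B C] assoc_mult_mat[OF C' B' R] ..
  also have "\<dots> = mat_adjoint C * (mat_adjoint B * R * B) * C"
    unfolding assoc_mult_mat[OF C' BR mult_carrier_mat[OF B C]]
      assoc_mult_mat[OF C' mult_carrier_mat[OF BR B] C] assoc_mult_mat[OF BR B C] ..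
  finally show ?thesis .
qed

lemma mult_adjoint_mult:
  fixes B C :: "complex mat"
  assumes B: "B \<in> carrier_mat n m" and C: "C \<in> carrier_mat m k"
  shows "B * C * mat_adjoint C * mat_adjoint B = B * C * mat_adjoint (B * C)"
  unfolding mat_adjoint_mult[OF B C]
  by (rule assoc_mult_mat[OF mult_carrier_mat[OF B C]]) (use B C in auto)

text \<open>Two readings of one Pythagorean identity for the projection
  \<open>U * mat_adjoint U\<close>: the first is a quadratic form in G for fixed U, the second
  isolates the dependence on U for fixed G.\<close>

lemma isometry_residual:
  assumes U: "U \<in> carrier_mat n r" and iso: "mat_adjoint U * U = 1\<^sub>m r" and G: "G \<in> carrier_mat n d"
  shows "complex_of_real ((frob_norm (G - U * mat_adjoint U * G))\<^sup>2)
      = mat_trace (mat_adjoint G * (1\<^sub>m n - U * mat_adjoint U) * G)" (is "?L = ?A")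
    and "complex_of_real ((frob_norm (G - U * mat_adjoint U * G))\<^sup>2)
      = mat_trace (mat_adjoint G * G) - mat_trace (mat_adjoint U * (G * mat_adjoint G) * U)"
proof -
  define P where "P = U * mat_adjoint U"
  have P: "P \<in> carrier_mat n n" using U by (auto simp: P_def intro!: mult_carrier_mat)
  have aP: "mat_adjoint P = P" using U by (simp add: P_def mat_adjoint_mult[of _ n r _ n])
  have "P * P = U * (mat_adjoint U * U) * mat_adjoint U"
    using U by (simp add: P_def assoc_mult_mat[of _ n r _ n _ n] assoc_mult_mat[of _ n r _ r _ n]
        assoc_mult_mat[of _ r n _ r _ n] mult_carrier_mat)
  then have PP: "P * P = P" using U by (simp add: iso P_def)
  have PG: "P * G \<in> carrier_mat n d" using P G by simp
  have "mat_adjoint (P * G) * (P * G) = mat_adjoint G * (P * P * G)"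
    using P G by (simp add: mat_adjoint_mult[of _ n n _ d] aP assoc_mult_mat[of _ d n _ n _ d]
        assoc_mult_mat[of _ n n _ n _ d] mult_carrier_mat)
  then have PGPG: "mat_adjoint (P * G) * (P * G) = mat_adjoint G * (P * G)" by (simp add: PP)
  have PGG: "mat_adjoint (P * G) * G = mat_adjoint G * (P * G)"
    using P G by (simp add: mat_adjoint_mult[of _ n n _ d] aP assoc_mult_mat[of _ d n _ n _ d])
  have aG: "mat_adjoint G \<in> carrier_mat d n" and aPG: "mat_adjoint (P * G) \<in> carrier_mat d n"
    using G PG by simp_all
  have GG: "mat_adjoint G * G \<in> carrier_mat d d" and GPG: "mat_adjoint G * (P * G) \<in> carrier_mat d d"
    using G PG by (auto intro!: mult_carrier_mat)
  have "?L = mat_trace ((mat_adjoint G - mat_adjoint (P * G)) * (G - P * G))"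
    unfolding frob_norm_sq P_def[symmetric] using G PG by (simp add: mat_adjoint_minus[of _ n d])
  also have "(mat_adjoint G - mat_adjoint (P * G)) * (G - P * G)
      = mat_adjoint G * G - mat_adjoint G * (P * G)"
  proof -
    have "(mat_adjoint G - mat_adjoint (P * G)) * (G - P * G)
        = mat_adjoint G * (G - P * G) - mat_adjoint (P * G) * (G - P * G)"
      by (rule minus_mult_distrib_mat[OF aG aPG minus_carrier_mat[OF PG]])
    \<comment> \<open>The subtracted product vanishes because the residual \<open>G - P * G\<close>
      is orthogonal to the range of P.\<close>
    also have "\<dots> = (mat_adjoint G * G - mat_adjoint G * (P * G)) - 0\<^sub>m d d"
      unfolding mult_minus_distrib_mat[OF aG G PG] mult_minus_distrib_mat[OF aPG G PG] PGPG PGG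
        minus_r_inv_mat[OF GPG] ..
    also have "\<dots> = mat_adjoint G * G - mat_adjoint G * (P * G)"
      by (rule eq_matI) (use PG in auto)
    finally show ?thesis .
  qed
  finally have L: "?L = mat_trace (mat_adjoint G * G - mat_adjoint G * (P * G))" .
  also have "mat_adjoint G * G - mat_adjoint G * (P * G) = mat_adjoint G * (1\<^sub>m n - P) * G"
    unfolding assoc_mult_mat[OF aG minus_carrier_mat[OF P] G]
      minus_mult_distrib_mat[OF one_carrier_mat P G] left_mult_one_mat[OF G]
      mult_minus_distrib_mat[OF aG G PG] ..
  finally show "?L = ?A" by (simp add: P_def)
  have "mat_trace (mat_adjoint G * (P * G))
      = mat_trace ((mat_adjoint G * U) * (mat_adjoint U * G))"
    using G U by (simp add: P_def assoc_mult_mat[of _ d n _ r _ d] assoc_mult_mat[of _ n r _ n _ d]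
        mult_carrier_mat)
  \<comment> \<open>Cyclicity of the trace moves U to the outside.\<close>
  also have "\<dots> = mat_trace ((mat_adjoint U * G) * (mat_adjoint G * U))"
    using G U by (intro mat_trace_comm[of _ d r]) (auto intro!: mult_carrier_mat)
  also have "(mat_adjoint U * G) * (mat_adjoint G * U) = mat_adjoint U * (G * mat_adjoint G) * U"
    using G U by (simp add: assoc_mult_mat[of _ r n _ d _ r] assoc_mult_mat[of _ r n _ n _ r]
        assoc_mult_mat[of _ n d _ n _ r] mult_carrier_mat)
  finally show "?L = mat_trace (mat_adjoint G * G) - mat_trace (mat_adjoint U * (G * mat_adjoint G) * U)"
    using L GG GPG by (simp add: mat_trace_minus[of _ d])
qed

section \<open>Grouping the leakage by receiver and by transmitter\<close>

definition leak ::
  "(nat \<Rightarrow> nat \<Rightarrow> complex mat) \<Rightarrow> (nat \<Rightarrow> complex mat) \<Rightarrow> (nat \<Rightarrow> complex mat) \<Rightarrow> nat \<Rightarrow> nat \<Rightarrow> real" where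
  "leak H F U k l = (frob_norm (H k l * F l - U k * mat_adjoint (U k) * H k l * F l))\<^sup>2"

text \<open>The eavesdropper sum fits the same pattern, since removing K + 1 from
  \<open>{1..K}\<close> removes nothing.\<close>

lemma leakage_by_receiver:
  "leakage K H F U = (\<Sum>k\<in>{1..K + 1}. \<Sum>l\<in>{1..K} - {k}. leak H F U k l)"
  by (simp add: leakage_def leak_def)

lemma leakage_by_transmitter:
  "leakage K H F U = (\<Sum>l\<in>{1..K}. \<Sum>k\<in>{1..K + 1} - {l}. leak H F U k l)"
proof -
  \<comment> \<open>Padding with zeros makes the index set a rectangle, on which the sums can be
    exchanged.\<close>
  have "leakage K H F U
      = (\<Sum>k\<in>{1..K + 1}. \<Sum>l\<in>{1..K}. if l \<noteq> k then leak H F U k l else 0)"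
    unfolding leakage_by_receiver by (intro sum.cong sum.mono_neutral_cong_left) auto
  also have "\<dots> = (\<Sum>l\<in>{1..K}. \<Sum>k\<in>{1..K + 1}. if l \<noteq> k then leak H F U k l else 0)"
    by (rule sum.swap)
  also have "\<dots> = (\<Sum>l\<in>{1..K}. \<Sum>k\<in>{1..K + 1} - {l}. leak H F U k l)"
    by (intro sum.cong sum.mono_neutral_cong_right) auto
  finally show ?thesis .
qed

text \<open>With \<open>n k\<close> the number of antennas at receiver k (eavesdropper included) and \<open>r k\<close> the number
  of columns of \<open>U k\<close>, the K + 1 receivers can be treated alike.\<close>

locale leakage_network =
  fixes K M d :: nat and H :: "nat \<Rightarrow> nat \<Rightarrow> complex mat" and n r :: "nat \<Rightarrow> nat"
  assumes H: "k \<in> {1..K + 1} \<Longrightarrow> l \<in> {1..K} \<Longrightarrow> H k l \<in> carrier_mat (n k) M"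
begin

definition isometries :: "(nat \<Rightarrow> complex mat) \<Rightarrow> bool" where
  "isometries U \<longleftrightarrow>
     (\<forall>k\<in>{1..K + 1}. U k \<in> carrier_mat (n k) (r k) \<and> mat_adjoint (U k) * U k = 1\<^sub>m (r k))"

lemma isometriesD:
  assumes "isometries U" "k \<in> {1..K + 1}"
  shows "U k \<in> carrier_mat (n k) (r k)" "mat_adjoint (U k) * U k = 1\<^sub>m (r k)"
  using assms by (auto simp: isometries_def)

section \<open>Monotonicity of the two half-steps\<close>

lemma leak_eq_precoder_form:
  assumes U: "isometries U" and k: "k \<in> {1..K + 1}" and l: "l \<in> {1..K}" and F: "F l \<in> carrier_mat M d"
  shows "complex_of_real (leak H F U k l) = mat_trace (mat_adjoint (F l) *
    (mat_adjoint (H k l) * (1\<^sub>m (n k) - U k * mat_adjoint (U k)) * H k l) * F l)"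
proof -
  note Uk = isometriesD[OF U k]
  have HF: "H k l * F l \<in> carrier_mat (n k) d" using H[OF k l] F by simp
  have UU: "U k * mat_adjoint (U k) \<in> carrier_mat (n k) (n k)"
    using Uk by (auto intro!: mult_carrier_mat)
  have R: "1\<^sub>m (n k) - U k * mat_adjoint (U k) \<in> carrier_mat (n k) (n k)" (is "?R \<in> _")
    using UU by (rule minus_carrier_mat)
  have "leak H F U k l = (frob_norm (H k l * F l - U k * mat_adjoint (U k) * (H k l * F l)))\<^sup>2"
    using H[OF k l] F UU by (simp add: leak_def assoc_mult_mat[of _ "n k" "n k" _ M _ d])
  then have "complex_of_real (leak H F U k l) = mat_trace (mat_adjoint (H k l * F l) * ?R * (H k l * F l))"
    using isometry_residual(1)[OF Uk HF] by simp
  also have "mat_adjoint (H k l * F l) * ?R * (H k l * F l)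
      = mat_adjoint (F l) * (mat_adjoint (H k l) * ?R * H k l) * F l"
    by (rule mat_adjoint_congruence_mult[OF R H[OF k l] F])
  finally show ?thesis .
qed

text \<open>Only the second trace involves U, and its matrix is one summand of the matrix in the
  subspace update.\<close>

lemma leak_eq_subspace_form:
  assumes U: "isometries U" and k: "k \<in> {1..K + 1}" and l: "l \<in> {1..K}" and F: "F l \<in> carrier_mat M d"
  shows "complex_of_real (leak H F U k l) = mat_trace (mat_adjoint (H k l * F l) * (H k l * F l))
    - mat_trace (mat_adjoint (U k) * (H k l * F l * mat_adjoint (F l) * mat_adjoint (H k l)) * U k)"
proof -
  note Uk = isometriesD[OF U k]
  have HF: "H k l * F l \<in> carrier_mat (n k) d" using H[OF k l] F by simp
  have UU: "U k * mat_adjoint (U k) \<in> carrier_mat (n k) (n k)"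
    using Uk by (auto intro!: mult_carrier_mat)
  have "leak H F U k l = (frob_norm (H k l * F l - U k * mat_adjoint (U k) * (H k l * F l)))\<^sup>2"
    using H[OF k l] F UU by (simp add: leak_def assoc_mult_mat[of _ "n k" "n k" _ M _ d])
  then show ?thesis
    unfolding mult_adjoint_mult[OF H[OF k l] F] using isometry_residual(2)[OF Uk HF] by simp
qed

text \<open>For fixed U the leakage splits into one quadratic form per transmitter, so each precoder
  can be optimized alone. Admissibility of the new precoders is carried along as the invariant that
  makes them competitors in the next iteration.\<close>

lemma precoder_update_leakage_le:
  assumes U: "isometries U" and Pt: "0 < Pt" "0 < d"
    and F: "admissible_precoders K M d Pt F" and F': "precoder_update K M d Pt H U F'"
  shows "leakage K H F' U \<le> leakage K H F U" and "admissible_precoders K M d Pt F'"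
proof -
  define s where "s = sqrt (Pt / real d)"
  have s: "0 < s" "s * s = Pt / real d" using Pt by (simp_all add: s_def)
  \<comment> \<open>Keeping \<open>dim_row (H k l)\<close> makes \<open>X l\<close> literally the
    matrix of \<open>precoder_update\<close>; \<open>dimH\<close> turns it into \<open>n k\<close>
    where needed.\<close>
  define A where
    "A l = (\<lambda>k. mat_adjoint (H k l) * (1\<^sub>m (dim_row (H k l)) - U k * mat_adjoint (U k)) * H k l)" for l
  have dimH: "dim_row (H k l) = n k" if "k \<in> {1..K + 1}" "l \<in> {1..K}" for k l
    using H[OF that] by simp
  have A: "A l k \<in> carrier_mat M M \<and> mat_adjoint (A l k) = A l k"
    if k: "k \<in> {1..K + 1}" and l: "l \<in> {1..K}" for k l
  proof -
    have UU: "U k * mat_adjoint (U k) \<in> carrier_mat (n k) (n k)"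
      using isometriesD[OF U k] by (auto intro!: mult_carrier_mat)
    have R: "1\<^sub>m (n k) - U k * mat_adjoint (U k) \<in> carrier_mat (n k) (n k)"
      using UU by (rule minus_carrier_mat)
    have "mat_adjoint (1\<^sub>m (n k) - U k * mat_adjoint (U k)) = 1\<^sub>m (n k) - U k * mat_adjoint (U k)"
      using UU isometriesD(1)[OF U k]
      by (simp add: mat_adjoint_minus[of _ "n k" "n k"] mat_adjoint_mult[of _ "n k" "r k" _ "n k"])
    from mat_adjoint_congruence[OF R this H[OF k l]] show ?thesis
      using H[OF k l] R unfolding A_def dimH[OF k l] by (auto intro!: mult_carrier_mat)
  qed
  define X where "X l = mat_sum M M (A l) ({1..K + 1} - {l})" for l
  have X: "X l \<in> carrier_mat M M" for l by (simp add: X_def)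
  have leak_sum: "(\<Sum>k\<in>{1..K + 1} - {l}. leak H G U k l) = Re (mat_trace (mat_adjoint (G l) * X l * G l))"
    if l: "l \<in> {1..K}" and G: "G l \<in> carrier_mat M d" for G l
  proof -
    have "mat_trace (mat_adjoint (G l) * X l * G l)
        = (\<Sum>k\<in>{1..K + 1} - {l}. mat_trace (mat_adjoint (G l) * A l k * G l))"
      unfolding X_def using A[OF _ l] G by (intro mat_trace_compression_mat_sum) auto
    also have "\<dots> = (\<Sum>k\<in>{1..K + 1} - {l}. complex_of_real (leak H G U k l))"
      using leak_eq_precoder_form[where F = G, OF U _ l G] dimH[OF _ l]
      by (intro sum.cong) (auto simp: A_def)
    finally show ?thesis by simp
  qed
  have upd: "\<exists>V. zeta_min d (X l) V \<and> V \<in> carrier_mat M d \<and> mat_adjoint V * V = 1\<^sub>m d \<and>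
      F' l = complex_of_real s \<cdot>\<^sub>m V" if "l \<in> {1..K}" for l
  proof -
    have "\<exists>V. zeta_min d (X l) V \<and> F' l = complex_of_real s \<cdot>\<^sub>m V"
      using bspec[OF F'[unfolded precoder_update_def] that] unfolding s_def X_def A_def .
    then obtain V where V: "zeta_min d (X l) V" "F' l = complex_of_real s \<cdot>\<^sub>m V" by blast
    moreover from V(1) X[of l] have "V \<in> carrier_mat M d" "mat_adjoint V * V = 1\<^sub>m d"
      by (auto simp: zeta_min_def eigenvalue_split_def)
    ultimately show ?thesis by blast
  qed
  have smult_iso: "mat_adjoint (complex_of_real c \<cdot>\<^sub>m V) * (complex_of_real c \<cdot>\<^sub>m V)
      = complex_of_real (c * c) \<cdot>\<^sub>m (mat_adjoint V * V)" if "V \<in> carrier_mat M d" for V c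
    using that by (simp add: mat_adjoint_smult mult_smult_assoc_mat[of _ d M] mult_smult_distrib[of _ d M])
       (auto intro!: eq_matI)
  show "admissible_precoders K M d Pt F'"
    unfolding admissible_precoders_def
  proof
    fix l assume "l \<in> {1..K}"
    from upd[OF this] obtain V where V: "V \<in> carrier_mat M d" "mat_adjoint V * V = 1\<^sub>m d"
      "F' l = complex_of_real s \<cdot>\<^sub>m V" by blast
    then show "F' l \<in> carrier_mat M d \<and>
        mat_adjoint (F' l) * F' l = complex_of_real (Pt / real d) \<cdot>\<^sub>m 1\<^sub>m d"
      using smult_iso[OF V(1), of s] s(2) by simp
  qed
  show "leakage K H F' U \<le> leakage K H F U"
    unfolding leakage_by_transmitter
  proof (rule sum_mono)
    fix l assume l: "l \<in> {1..K}"
    from upd[OF l] obtain V where V: "zeta_min d (X l) V" "V \<in> carrier_mat M d"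
      "F' l = complex_of_real s \<cdot>\<^sub>m V" by blast
    have Fl: "F l \<in> carrier_mat M d"
      "mat_adjoint (F l) * F l = complex_of_real (Pt / real d) \<cdot>\<^sub>m 1\<^sub>m d"
      using F l by (auto simp: admissible_precoders_def)
    \<comment> \<open>The old precoder, rescaled to an isometry, is the competitor of V in Ky Fan's
      theorem.\<close>
    define W where "W = complex_of_real (1 / s) \<cdot>\<^sub>m F l"
    have W: "W \<in> carrier_mat M d" using Fl by (simp add: W_def)
    have "1 / s * (1 / s) * (Pt / real d) = 1"
      using s by (simp add: s(2)[symmetric])
    then have c1: "complex_of_real (1 / s * (1 / s)) * complex_of_real (Pt / real d) = 1"
      by (metis of_real_1 of_real_mult)
    have "mat_adjoint W * W = (complex_of_real (1 / s * (1 / s)) * complex_of_real (Pt / real d)) \<cdot>\<^sub>m 1\<^sub>m d"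
      unfolding W_def smult_iso[OF Fl(1)] Fl(2) by (rule eq_matI) auto
    then have isoW: "mat_adjoint W * W = 1\<^sub>m d" unfolding c1 by (auto intro!: eq_matI)
    have FW: "F l = complex_of_real s \<cdot>\<^sub>m W"
      using s by (auto simp: W_def intro!: eq_matI)
    have F'l: "F' l \<in> carrier_mat M d" using V by simp
    have "mat_adjoint (X l) = X l"
      unfolding X_def using A[OF _ l] by (intro mat_sum_hermitian) auto
    from zeta_min_trace_le[OF X this V(1) W isoW]
    show "(\<Sum>k\<in>{1..K + 1} - {l}. leak H F' U k l) \<le> (\<Sum>k\<in>{1..K + 1} - {l}. leak H F U k l)"
      unfolding leak_sum[where G = F', OF l F'l]
        leak_sum[where G = F, OF l Fl(1)] unfolding V(3) FW
        mat_trace_compression_smult[OF V(2) X] mat_trace_compression_smult[OF W X]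
      by (simp add: mult_left_mono)
  qed
qed

text \<open>For fixed F the leakage at each receiver is a constant minus the trace captured by its
  subspace. The update maximizes that trace, with the old \<open>U k\<close> as competitor, and
  hence minimizes the leakage receiver by receiver.\<close>

lemma subspace_update_leakage_le:
  assumes U: "isometries U" and F: "\<And>l. l \<in> {1..K} \<Longrightarrow> F l \<in> carrier_mat M d"
    and U': "\<And>k. k \<in> {1..K + 1} \<Longrightarrow> zeta_max (r k) (mat_sum (n k) (n k)
      (\<lambda>l. H k l * F l * mat_adjoint (F l) * mat_adjoint (H k l)) ({1..K} - {k})) (U' k)"
    and isoU': "isometries U'"
  shows "leakage K H F U' \<le> leakage K H F U"
  unfolding leakage_by_receiver
proof (rule sum_mono)
  fix k assume k: "k \<in> {1..K + 1}"
  define B where "B l = H k l * F l * mat_adjoint (F l) * mat_adjoint (H k l)" for l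
  have B: "B l \<in> carrier_mat (n k) (n k) \<and> mat_adjoint (B l) = B l" if l: "l \<in> {1..K}" for l
  proof -
    have "H k l * F l \<in> carrier_mat (n k) d" using H[OF k l] F[OF l] by simp
    then show ?thesis
      unfolding B_def mult_adjoint_mult[OF H[OF k l] F[OF l]]
      by (auto simp: mat_adjoint_mult[of _ "n k" d _ "n k"] intro!: mult_carrier_mat)
  qed
  define S where "S = mat_sum (n k) (n k) B ({1..K} - {k})"
  have S: "S \<in> carrier_mat (n k) (n k)" "mat_adjoint S = S"
    using B by (auto simp: S_def intro!: mat_sum_hermitian)
  have leak_sum: "(\<Sum>l\<in>{1..K} - {k}. leak H F V k l)
      = (\<Sum>l\<in>{1..K} - {k}. Re (mat_trace (mat_adjoint (H k l * F l) * (H k l * F l))))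
        - Re (mat_trace (mat_adjoint (V k) * S * V k))" if V: "isometries V" for V
  proof -
    have "mat_trace (mat_adjoint (V k) * S * V k)
        = (\<Sum>l\<in>{1..K} - {k}. mat_trace (mat_adjoint (V k) * B l * V k))"
      unfolding S_def using B isometriesD[OF V k] by (intro mat_trace_compression_mat_sum) auto
    moreover have "leak H F V k l = Re (mat_trace (mat_adjoint (H k l * F l) * (H k l * F l)))
        - Re (mat_trace (mat_adjoint (V k) * B l * V k))" if "l \<in> {1..K} - {k}" for l
      using arg_cong[OF leak_eq_subspace_form[of V k l F], of Re] V k F that unfolding B_def by simp
    ultimately show ?thesis by (simp add: sum_subtractf)
  qed
  have "zeta_max (r k) S (U' k)" using U'[OF k] unfolding S_def B_def .
  from zeta_max_trace_ge[OF S this isometriesD[OF U k]]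
  show "(\<Sum>l\<in>{1..K} - {k}. leak H F U' k l) \<le> (\<Sum>l\<in>{1..K} - {k}. leak H F U k l)"
    unfolding leak_sum[OF U] leak_sum[OF isoU'] by simp
qed

end

section \<open>Monotone convergence of the iterates\<close>

theorem theorem1:
  fixes K M N Ne d :: nat and Pt :: real
    and H :: "nat \<Rightarrow> nat \<Rightarrow> complex mat"
    and F U :: "nat \<Rightarrow> nat \<Rightarrow> complex mat"
  assumes "0 < K" and "0 < M" and "0 < N" and "0 < Ne" and "0 < d"
    and "d \<le> min M (min N Ne)"
    and "0 < Pt"
    and "\<And>k l. k \<in> {1..K} \<Longrightarrow> l \<in> {1..K} \<Longrightarrow> H k l \<in> carrier_mat N M"
    and "\<And>l. l \<in> {1..K} \<Longrightarrow> H (K + 1) l \<in> carrier_mat Ne M"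
    and "wslm_iterates K M N Ne d Pt H F U"
  shows "(\<forall>\<kappa>. leakage K H (F (Suc \<kappa>)) (U (Suc \<kappa>)) \<le> leakage K H (F \<kappa>) (U \<kappa>)) \<and>
         convergent (\<lambda>\<kappa>. leakage K H (F \<kappa>) (U \<kappa>))"
proof -
  define n where "n k = (if k = K + 1 then Ne else N)" for k
  define r where "r k = (if k = K + 1 then d else N - d)" for k
  have H: "H k l \<in> carrier_mat (n k) M" if "k \<in> {1..K + 1}" "l \<in> {1..K}" for k l
    using assms(8)[of k l] assms(9)[of l] that by (auto simp: n_def)
  interpret leakage_network K M d H n r
    by unfold_locales (rule H)
  \<comment> \<open>The initial subspaces also come from a subspace update, so the relation holds at
    every index, including 0.\<close>
  have sub: "subspace_update K N Ne d H (F \<kappa>) (U \<kappa>)" for \<kappa>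
    using assms(10) by (cases \<kappa>) (auto simp: wslm_iterates_def)
  have zeta: "zeta_max (r k) (mat_sum (n k) (n k)
      (\<lambda>l. H k l * F \<kappa> l * mat_adjoint (F \<kappa> l) * mat_adjoint (H k l)) ({1..K} - {k})) (U \<kappa> k)"
    if k: "k \<in> {1..K + 1}" for \<kappa> k
  proof (cases "k = K + 1")
    case True
    then have "{1..K} - {k} = {1..K}" by auto
    then show ?thesis
      using sub[of \<kappa>] unfolding subspace_update_def n_def r_def by (simp add: True)
  next
    case False
    then have "k \<in> {1..K}" using k by auto
    then show ?thesis
      using sub[of \<kappa>] False unfolding subspace_update_def n_def r_def by auto
  qed
  have iso: "isometries (U \<kappa>)" for \<kappa>
    unfolding isometries_def using zeta[of _ \<kappa>]
    by (fastforce simp: zeta_max_def eigenvalue_split_def mat_sum_def)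
  have upd: "precoder_update K M d Pt H (U \<kappa>) (F (Suc \<kappa>))" for \<kappa>
    using assms(10) by (simp add: wslm_iterates_def)
  have adm: "admissible_precoders K M d Pt (F \<kappa>)" for \<kappa>
  proof (induction \<kappa>)
    case 0
    then show ?case using assms(10) by (simp add: wslm_iterates_def)
  next
    case (Suc \<kappa>)
    then show ?case using precoder_update_leakage_le(2)[OF iso assms(7,5) _ upd] by blast
  qed
  have mono: "leakage K H (F (Suc \<kappa>)) (U (Suc \<kappa>)) \<le> leakage K H (F \<kappa>) (U \<kappa>)" for \<kappa>
  proof -
    \<comment> \<open>The intermediate pair of new precoders and old subspaces separates the two
      half-steps.\<close>
    have "leakage K H (F (Suc \<kappa>)) (U (Suc \<kappa>)) \<le> leakage K H (F (Suc \<kappa>)) (U \<kappa>)"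
      using adm[of "Suc \<kappa>"]
      by (intro subspace_update_leakage_le[OF iso _ zeta iso]) (auto simp: admissible_precoders_def)
    also have "\<dots> \<le> leakage K H (F \<kappa>) (U \<kappa>)"
      by (rule precoder_update_leakage_le(1)[OF iso assms(7,5) adm upd])
    finally show ?thesis .
  qed
  \<comment> \<open>As a sum of squares the leakage is bounded below by 0, so its monotone decrease
    forces convergence.\<close>
  have "0 \<le> leakage K H (F \<kappa>) (U \<kappa>)" for \<kappa>
    by (simp add: leakage_def sum_nonneg)
  then have "Bseq (\<lambda>\<kappa>. leakage K H (F \<kappa>) (U \<kappa>))"
    using decseq_SucI[of "\<lambda>\<kappa>. leakage K H (F \<kappa>) (U \<kappa>)", OF mono]
    by (intro decseq_bounded) auto
  moreover have "monoseq (\<lambda>\<kappa>. leakage K H (F \<kappa>) (U \<kappa>))"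
    using mono by (intro decseq_imp_monoseq decseq_SucI) auto
  ultimately show ?thesis using mono Bseq_monoseq_convergent by blast
qed

end
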